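(* The formula \[ \exists S_1,\ldots,S_k.\ \exists d.\ \bigwedge_{i=1}^k S_i = \{ n\in\mathbb{N} : \phi_i(d(n))\} \ \land\ \exists \overline{t}\in M(L_1,\ldots,L_m).\ \bigwedge_{i=1}^k S_i = \{n\in\mathbb{N} : t_i(n)\} \] (which is true iff $\mathcal{L}(M)\neq\emptyset$) is equivalent to the formula \[ \begin{split} \exists s \in [m].\ \exists \sigma: [s] \hookrightarrow [m].\ \exists \beta_{1}, \ldots,\beta_{s} \in \{0,1\}^k.\ \bigwedge_{j = 1}^s \exists d.\ \phi^{\beta_{j}}(d) \land \exists k_1,\ldots,k_m.\ \exists S_1,\ldots, S_k, P_1,\ldots,P_s.\\ \rho(k_1,\ldots, k_m) \land \bigwedge_{i = 1}^s P_i \subseteq p_{L_{\sigma(i)}} \land \bigcup_{i = 1}^m p_{L_i} = \dot{\bigcup}_{i = 1}^s P_i \land \bigwedge_{i = 1}^s |P_i| = k_{\sigma(i)} \land \bigwedge_{i = 1}^s p_{\beta_i} \cap P_{i} \neq \emptyset, \end{split} \] where $\sigma$ is an injection from $\{1,\ldots,s\}$ to $\{1,\ldots,m\}$ and $\rho$ is the existential Presburger formula defining the Parikh image of $M_S(L_1,\ldots,L_m)$.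
   Context: $\mathcal{A}=(\mathfrak{D},\Psi,I,\perp,\top,\vee,\wedge,\neg)$ is an effective Boolean algebra ($I:\Psi\to2^{\mathfrak{D}}$ the interpretation map respecting Boolean operations, with decidable non-emptiness of $I(\psi)$), finitely generated by atomic predicates $\phi_1,\ldots,\phi_k$. $M=(\mathcal{A},Q,q_0,F,\Delta)$ is a symbolic finite automaton whose transitions are labelled by predicates $\psi_1,\ldots,\psi_m$; $L_1,\ldots,L_m$ are the (distinct) corresponding propositional formulas over set variables $S_1,\ldots,S_k$ (replace $\phi_i$ by $S_i$). $d(n)$ is the $n$-th letter of a word $d\in\mathfrak{D}^*$. A table is a sequence of bit-vectors in $\{0,1\}^k$, written $\overline{t}=(t_1,\ldots,t_k)$, $t_i(n)$ the $i$-th bit of the $n$-th vector; $M(L_1,\ldots,L_m)$ is the set of tables accepted by $M$ with guards replaced by the $L_j$ (a bit-vector may take an $L_j$-transition iff it satisfies $L_j$). $M_S(L_1,\ldots,L_m)$ is the regular language of symbolic tables, i.e. words over the alphabet $\{L_1,\ldots,L_m\}$ accepted by $M$ with guards replaced by $L_j$. Its Parikh image is $\{(|\overline{s}|_{L_1},\ldots,|\overline{s}|_{L_m}) : \overline{s}\in M_S(L_1,\ldots,L_m)\}$, where $|\overline{s}|_{L_i}$ counts occurrences of $L_i$; by Seidl–Schwentick–Muscholl–Habermehl it is defined by an existential Presburger formula $\rho$ of size $O(|M|)$. Notation: $S^1:=S$, $S^0:=S^c$; $p_\beta:=\bigcap_{i=1}^k S_i^{\beta_i}$ for $\beta\in\{0,1\}^k$;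 $p_L:=\bigcup_{\beta\models L}p_\beta$; $\phi^\beta(d):=\bigwedge_{i=1}^k\phi_i^{\beta(i)}(d)$ with $\phi^1=\phi$, $\phi^0=\neg\phi$; $\dot{\cup}$ denotes union of pairwise disjoint sets; $[n]:=\{1,\ldots,n\}$.
   Formalization: As printed this fails (e.g. unsatisfiable guards, L(M)={ε}); proved with sets and complements in a finite universe of positions, |t|=|d| required, k_j=0 added for j outside the range of σ, and s=0 allowed; s∈[m] is claimed only if ε∉L(M). *)

theory Defs
  imports Main "HOL-Library.FuncSet" "HOL-Library.Disjoint_Sets"
begin

section \<open>Boolean algebras of predicates\<close>

record ('d, 'p) pred_algebra =
  Dom :: "'d set"
  Preds :: "'p set"
  Interp :: "'p \<Rightarrow> 'd set"
  PBot :: 'p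
  PTop :: 'p
  POr :: "'p \<Rightarrow> 'p \<Rightarrow> 'p"
  PAnd :: "'p \<Rightarrow> 'p \<Rightarrow> 'p"
  PNeg :: "'p \<Rightarrow> 'p"

text \<open>
  The Boolean laws are imposed on the interpretations only; the predicates themselves may be
  syntactic objects. Effectiveness (decidability of \<open>Interp A p \<noteq> {}\<close>) has no
  counterpart here: it concerns algorithms on the algebra and not the truth of formulas about it.
\<close>

definition boolean_pred_algebra :: "('d, 'p) pred_algebra \<Rightarrow> bool" where
  "boolean_pred_algebra A \<longleftrightarrow>
     PBot A \<in> Preds A \<and> PTop A \<in> Preds A \<and>
     (\<forall>p \<in> Preds A. \<forall>q \<in> Preds A. POr A p q \<in> Preds A \<and> PAnd A p q \<in> Preds A) \<and>
     (\<forall>p \<in> Preds A. PNeg A p \<in> Preds A) \<and>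
     (\<forall>p \<in> Preds A. Interp A p \<subseteq> Dom A) \<and>
     Interp A (PBot A) = {} \<and> Interp A (PTop A) = Dom A \<and>
     (\<forall>p \<in> Preds A. \<forall>q \<in> Preds A.
        Interp A (POr A p q) = Interp A p \<union> Interp A q \<and>
        Interp A (PAnd A p q) = Interp A p \<inter> Interp A q) \<and>
     (\<forall>p \<in> Preds A. Interp A (PNeg A p) = Dom A - Interp A p)"


section \<open>Propositional formulas and bit-vectors\<close>

datatype bform = Atom nat | Bot | Top | Or bform bform | And bform bform | Neg bform

fun atoms :: "bform \<Rightarrow> nat set" where
  "atoms (Atom i) = {i}"
| "atoms Bot = {}"
| "atoms Top = {}"
| "atoms (Or F G) = atoms F \<union> atoms G"
| "atoms (And F G) = atoms F \<union> atoms G"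
| "atoms (Neg F) = atoms F"

fun models :: "(nat \<Rightarrow> bool) \<Rightarrow> bform \<Rightarrow> bool" where
  "models b (Atom i) \<longleftrightarrow> b i"
| "models b Bot \<longleftrightarrow> False"
| "models b Top \<longleftrightarrow> True"
| "models b (Or F G) \<longleftrightarrow> models b F \<or> models b G"
| "models b (And F G) \<longleftrightarrow> models b F \<and> models b G"
| "models b (Neg F) \<longleftrightarrow> \<not> models b F"

definition bitvecs :: "nat \<Rightarrow> (nat \<Rightarrow> bool) set" where
  "bitvecs k = {1..k} \<rightarrow>\<^sub>E UNIV"

fun pred_of :: "('d, 'p) pred_algebra \<Rightarrow> (nat \<Rightarrow> 'p) \<Rightarrow> bform \<Rightarrow> 'p" where
  "pred_of A \<phi> (Atom i) = \<phi> i"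
| "pred_of A \<phi> Bot = PBot A"
| "pred_of A \<phi> Top = PTop A"
| "pred_of A \<phi> (Or F G) = POr A (pred_of A \<phi> F) (pred_of A \<phi> G)"
| "pred_of A \<phi> (And F G) = PAnd A (pred_of A \<phi> F) (pred_of A \<phi> G)"
| "pred_of A \<phi> (Neg F) = PNeg A (pred_of A \<phi> F)"

definition generated_by :: "('d, 'p) pred_algebra \<Rightarrow> nat \<Rightarrow> (nat \<Rightarrow> 'p) \<Rightarrow> bool" where
  "generated_by A k \<phi> \<longleftrightarrow> Preds A = pred_of A \<phi> ` {F. atoms F \<subseteq> {1..k}}"

definition lit :: "('d, 'p) pred_algebra \<Rightarrow> 'p \<Rightarrow> bool \<Rightarrow> 'p" where
  "lit A p b = (if b then p else PNeg A p)"

definition has_type ::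
  "('d, 'p) pred_algebra \<Rightarrow> nat \<Rightarrow> (nat \<Rightarrow> 'p) \<Rightarrow> (nat \<Rightarrow> bool) \<Rightarrow> 'd \<Rightarrow> bool" where
  "has_type A k \<phi> \<beta> d \<longleftrightarrow> (\<forall>i \<in> {1..k}. d \<in> Interp A (lit A (\<phi> i) (\<beta> i)))"


section \<open>Automata\<close>

record ('q, 'g) automaton =
  States :: "'q set"
  Init :: 'q
  Final :: "'q set"
  Trans :: "('q \<times> 'g \<times> 'q) set"

definition guards :: "('q, 'g) automaton \<Rightarrow> 'g set" where
  "guards M = {g. \<exists>p q. (p, g, q) \<in> Trans M}"

definition symbolic_automaton :: "('d, 'p) pred_algebra \<Rightarrow> ('q, 'p) automaton \<Rightarrow> bool" where
  "symbolic_automaton A M \<longleftrightarrow>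
     finite (States M) \<and> Init M \<in> States M \<and> Final M \<subseteq> States M \<and>
     finite (Trans M) \<and> Trans M \<subseteq> States M \<times> Preds A \<times> States M"

text \<open>
  One notion of acceptance serves all three languages; \<open>sat g a\<close> tells whether the letter
  \<open>a\<close> may take a transition guarded by \<open>g\<close>.
\<close>

definition accepts :: "('g \<Rightarrow> 'a \<Rightarrow> bool) \<Rightarrow> ('q, 'g) automaton \<Rightarrow> 'a list \<Rightarrow> bool" where
  "accepts sat M w \<longleftrightarrow>
     (\<exists>r :: nat \<Rightarrow> 'q. r 0 = Init M \<and> r (length w) \<in> Final M \<and>
        (\<forall>n < length w. \<exists>g. (r n, g, r (Suc n)) \<in> Trans M \<and> sat g (w ! n)))"

definition language :: "('d, 'p) pred_algebra \<Rightarrow> ('q, 'p) automaton \<Rightarrow> 'd list set" where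
  "language A M = {d \<in> lists (Dom A). accepts (\<lambda>p a. a \<in> Interp A p) M d}"

definition replace_guards ::
  "('q, 'p) automaton \<Rightarrow> nat \<Rightarrow> (nat \<Rightarrow> 'p) \<Rightarrow> (nat \<Rightarrow> bform) \<Rightarrow> ('q, bform) automaton" where
  "replace_guards M m \<psi> L =
     \<lparr>States = States M, Init = Init M, Final = Final M,
      Trans = {(p, L j, q) | p j q. j \<in> {1..m} \<and> (p, \<psi> j, q) \<in> Trans M}\<rparr>"

definition tables :: "nat \<Rightarrow> ('q, bform) automaton \<Rightarrow> (nat \<Rightarrow> bool) list set" where
  "tables k M = {t \<in> lists (bitvecs k). accepts (\<lambda>F b. models b F) M t}"

definition symbolic_tables :: "('q, bform) automaton \<Rightarrow> bform list set" where
  "symbolic_tables M = {s. accepts (=) M s}"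

definition parikh_image :: "nat \<Rightarrow> (nat \<Rightarrow> 'a) \<Rightarrow> 'a list set \<Rightarrow> (nat \<Rightarrow> nat) set" where
  "parikh_image m L W = (\<lambda>w. \<lambda>j\<in>{1..m}. count_list w (L j)) ` W"


section \<open>Existential Presburger formulas over the natural numbers\<close>

datatype pterm = PVar nat | PConst nat | PAdd pterm pterm

fun pterm_vars :: "pterm \<Rightarrow> nat set" where
  "pterm_vars (PVar x) = {x}"
| "pterm_vars (PConst c) = {}"
| "pterm_vars (PAdd t u) = pterm_vars t \<union> pterm_vars u"

fun pterm_val :: "(nat \<Rightarrow> nat) \<Rightarrow> pterm \<Rightarrow> nat" where
  "pterm_val e (PVar x) = e x"
| "pterm_val e (PConst c) = c"
| "pterm_val e (PAdd t u) = pterm_val e t + pterm_val e u"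

datatype qfree =
  QEq pterm pterm | QLe pterm pterm | QAnd qfree qfree | QOr qfree qfree | QNot qfree

fun qfree_vars :: "qfree \<Rightarrow> nat set" where
  "qfree_vars (QEq t u) = pterm_vars t \<union> pterm_vars u"
| "qfree_vars (QLe t u) = pterm_vars t \<union> pterm_vars u"
| "qfree_vars (QAnd F G) = qfree_vars F \<union> qfree_vars G"
| "qfree_vars (QOr F G) = qfree_vars F \<union> qfree_vars G"
| "qfree_vars (QNot F) = qfree_vars F"

fun qfree_sat :: "(nat \<Rightarrow> nat) \<Rightarrow> qfree \<Rightarrow> bool" where
  "qfree_sat e (QEq t u) \<longleftrightarrow> pterm_val e t = pterm_val e u"
| "qfree_sat e (QLe t u) \<longleftrightarrow> pterm_val e t \<le> pterm_val e u"
| "qfree_sat e (QAnd F G) \<longleftrightarrow> qfree_sat e F \<and> qfree_sat e G"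
| "qfree_sat e (QOr F G) \<longleftrightarrow> qfree_sat e F \<or> qfree_sat e G"
| "qfree_sat e (QNot F) \<longleftrightarrow> \<not> qfree_sat e F"

text \<open>\<open>Exists xs F\<close> binds all the variables in \<open>xs\<close>.\<close>

datatype epresburger = Exists "nat list" qfree

fun free_vars :: "epresburger \<Rightarrow> nat set" where
  "free_vars (Exists xs F) = qfree_vars F - set xs"

fun holds :: "epresburger \<Rightarrow> (nat \<Rightarrow> nat) \<Rightarrow> bool" where
  "holds (Exists xs F) e \<longleftrightarrow> (\<exists>e'. (\<forall>x. x \<notin> set xs \<longrightarrow> e' x = e x) \<and> qfree_sat e' F)"

definition defines_set :: "epresburger \<Rightarrow> nat \<Rightarrow> (nat \<Rightarrow> nat) set \<Rightarrow> bool" where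
  "defines_set \<rho> m X \<longleftrightarrow>
     free_vars \<rho> \<subseteq> {1..m} \<and> (\<forall>e \<in> {1..m} \<rightarrow>\<^sub>E UNIV. holds \<rho> e \<longleftrightarrow> e \<in> X)"


section \<open>The two formulas\<close>

text \<open>
  Set variables range over subsets of a finite universe \<open>U\<close> of positions, and complements
  are relative to \<open>U\<close>. For a word or table of length \<open>l\<close> the universe is \<open>{..<l}\<close>.
\<close>

definition set_pow :: "nat set \<Rightarrow> nat set \<Rightarrow> bool \<Rightarrow> nat set" where
  "set_pow U X b = (if b then X else U - X)"

definition cell :: "nat set \<Rightarrow> nat \<Rightarrow> (nat \<Rightarrow> nat set) \<Rightarrow> (nat \<Rightarrow> bool) \<Rightarrow> nat set" where
  "cell U k S \<beta> = U \<inter> (\<Inter>i \<in> {1..k}. set_pow U (S i) (\<beta> i))"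

definition region :: "nat set \<Rightarrow> nat \<Rightarrow> (nat \<Rightarrow> nat set) \<Rightarrow> bform \<Rightarrow> nat set" where
  "region U k S F = (\<Union>\<beta> \<in> {\<beta> \<in> bitvecs k. models \<beta> F}. cell U k S \<beta>)"

text \<open>
  The word and the table are tabulated over the same positions. Equality of the lengths must be
  stated, since the sets \<open>S i\<close> do not see trailing positions at which every bit is 0.
\<close>

definition word_table_formula ::
  "('d, 'p) pred_algebra \<Rightarrow> ('q, 'p) automaton \<Rightarrow> nat \<Rightarrow> (nat \<Rightarrow> 'p) \<Rightarrow>
   nat \<Rightarrow> (nat \<Rightarrow> 'p) \<Rightarrow> (nat \<Rightarrow> bform) \<Rightarrow> bool" where
  "word_table_formula A M k \<phi> m \<psi> L \<longleftrightarrow>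
     (\<exists>S :: nat \<Rightarrow> nat set. \<exists>d \<in> lists (Dom A).
        (\<forall>i \<in> {1..k}. S i = {n. n < length d \<and> d ! n \<in> Interp A (\<phi> i)}) \<and>
        (\<exists>t \<in> tables k (replace_guards M m \<psi> L). length t = length d \<and>
           (\<forall>i \<in> {1..k}. S i = {n. n < length t \<and> (t ! n) i})))"

text \<open>
  The parameter \<open>s\<close> is the number of letters \<open>L j\<close> that occur in the symbolic table;
  it is 0 for the empty table, and only for it. The conjunct \<open>\<forall>j \<in> {1..m} - \<sigma> ` {1..s}. \<kappa> j = 0\<close> says that the other letters do not occur. Without it their
  counts would be unconstrained: if \<open>\<psi> 1\<close> is satisfiable, \<open>\<psi> 2\<close> is not, and \<open>M\<close> accepts
  exactly the words of length 2 whose letters satisfy \<open>\<psi> 1\<close> and \<open>\<psi> 2\<close> respectively, then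
  \<open>s = 1\<close>, \<open>\<sigma> 1 = 1\<close>, \<open>\<kappa> 1 = \<kappa> 2 = 1\<close> and \<open>P 1 = {0}\<close> would fulfil all the
  other conjuncts although the language is empty.
\<close>

definition cardinality_formula ::
  "('d, 'p) pred_algebra \<Rightarrow> nat \<Rightarrow> (nat \<Rightarrow> 'p) \<Rightarrow> nat \<Rightarrow> (nat \<Rightarrow> bform) \<Rightarrow>
   epresburger \<Rightarrow> nat \<Rightarrow> bool" where
  "cardinality_formula A k \<phi> m L \<rho> s \<longleftrightarrow>
     (\<exists>\<sigma> :: nat \<Rightarrow> nat. inj_on \<sigma> {1..s} \<and> \<sigma> ` {1..s} \<subseteq> {1..m} \<and>
      (\<exists>\<beta> :: nat \<Rightarrow> nat \<Rightarrow> bool. (\<forall>j \<in> {1..s}. \<beta> j \<in> bitvecs k) \<and>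
        (\<forall>j \<in> {1..s}. \<exists>d \<in> Dom A. has_type A k \<phi> (\<beta> j) d) \<and>
        (\<exists>\<kappa> \<in> {1..m} \<rightarrow>\<^sub>E UNIV.
         \<exists>N :: nat. \<exists>S :: nat \<Rightarrow> nat set. \<exists>P :: nat \<Rightarrow> nat set.
           (\<forall>i \<in> {1..k}. S i \<subseteq> {..<N}) \<and>
           holds \<rho> \<kappa> \<and>
           (\<forall>j \<in> {1..m} - \<sigma> ` {1..s}. \<kappa> j = 0) \<and>
           (\<forall>i \<in> {1..s}. P i \<subseteq> region {..<N} k S (L (\<sigma> i))) \<and>
           (\<Union>i \<in> {1..m}. region {..<N} k S (L i)) = (\<Union>i \<in> {1..s}. P i) \<and>
           disjoint_family_on P {1..s} \<and>
           (\<forall>i \<in> {1..s}. card (P i) = \<kappa> (\<sigma> i)) \<and>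
           (\<forall>i \<in> {1..s}. cell {..<N} k S (\<beta> i) \<inter> P i \<noteq> {}))))"

end

theory Submission
  imports Defs
begin

text \<open>
  A letter \<open>d\<close> satisfies the guard \<open>\<psi> j\<close> iff the bit-vector of the truth values
  \<open>\<phi> i d\<close> satisfies \<open>L j\<close>, so words and tables are interchangeable. Given an accepted word,
  let \<open>P i\<close> be the set of positions at which the run takes an \<open>L (\<sigma> i)\<close>-transition, where
  \<open>\<sigma>\<close> enumerates the guards that occur. Conversely, a common element of \<open>P i\<close> and of the
  cell of \<open>\<beta> i\<close> shows that \<open>\<beta> i\<close> satisfies \<open>L (\<sigma> i)\<close>. Hence a single letter of type \<open>\<beta> i\<close>
  can be substituted for every occurrence of \<open>L (\<sigma> i)\<close> in a symbolic table with the given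
  Parikh vector, and the result is an accepted word.
\<close>

section \<open>Cells, regions, runs and counting\<close>

lemma models_cong:
  assumes "\<And>i. i \<in> atoms F \<Longrightarrow> b i = c i"
  shows "models b F \<longleftrightarrow> models c F"
  using assms by (induction F) auto

lemma mem_cell_iff:
  "n \<in> cell U k S \<beta> \<longleftrightarrow> n \<in> U \<and> (\<forall>i \<in> {1..k}. n \<in> S i \<longleftrightarrow> \<beta> i)"
  by (auto simp: cell_def set_pow_def split: if_splits)

text \<open>Each position of \<open>U\<close> lies in the cell of exactly one bit-vector, its
  membership pattern in the sets \<open>S i\<close>. The bound on \<open>atoms F\<close> is needed
  because bit-vectors record this pattern on \<open>{1..k}\<close> only.\<close>

lemma mem_region_iff:
  assumes "atoms F \<subseteq> {1..k}"
  shows "n \<in> region U k S F \<longleftrightarrow> n \<in> U \<and> models (\<lambda>i. n \<in> S i) F"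
proof
  assume "n \<in> region U k S F"
  then obtain \<beta> where "models \<beta> F" "n \<in> cell U k S \<beta>"
    by (auto simp: region_def)
  moreover from this have "models \<beta> F \<longleftrightarrow> models (\<lambda>i. n \<in> S i) F"
    using assms by (intro models_cong) (auto simp: mem_cell_iff)
  ultimately show "n \<in> U \<and> models (\<lambda>i. n \<in> S i) F"
    by (simp add: mem_cell_iff)
next
  assume n: "n \<in> U \<and> models (\<lambda>i. n \<in> S i) F"
  let ?\<beta> = "\<lambda>i\<in>{1..k}. n \<in> S i"
  have "models ?\<beta> F \<longleftrightarrow> models (\<lambda>i. n \<in> S i) F"
    using assms by (intro models_cong) auto
  then have "?\<beta> \<in> {\<beta> \<in> bitvecs k. models \<beta> F}" "n \<in> cell U k S ?\<beta>"
    using n by (auto simp: bitvecs_def mem_cell_iff)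
  then show "n \<in> region U k S F"
    unfolding region_def by blast
qed

text \<open>A run mentions neither letters nor guards, so the same state sequence serves for
  \<open>v\<close>, provided each transition taken has a parallel one in \<open>M'\<close> that
  admits the new letter. This carries runs from tables to words, from words to tables and from
  symbolic tables to words.\<close>

lemma accepts_transfer:
  assumes "accepts sat M w" "Init M' = Init M" "Final M' = Final M" "length v = length w"
    and "\<And>p g q n. \<lbrakk>n < length w; (p, g, q) \<in> Trans M; sat g (w ! n)\<rbrakk> \<Longrightarrow>
           \<exists>h. (p, h, q) \<in> Trans M' \<and> sat' h (v ! n)"
  shows "accepts sat' M' v"
proof -
  obtain r where r: "r 0 = Init M" "r (length w) \<in> Final M"
    "\<And>n. n < length w \<Longrightarrow> \<exists>g. (r n, g, r (Suc n)) \<in> Trans M \<and> sat g (w ! n)"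
    using assms(1) unfolding accepts_def by blast
  then show ?thesis
    unfolding accepts_def using assms(2-5) by (intro exI[of _ r]) fastforce
qed

lemma accepts_letterD:
  assumes "accepts sat M w" "n < length w"
  shows "\<exists>p g q. (p, g, q) \<in> Trans M \<and> sat g (w ! n)"
  using assms unfolding accepts_def by blast

lemma replace_guards_simps [simp]:
  "Init (replace_guards M m \<psi> L) = Init M"
  "Final (replace_guards M m \<psi> L) = Final M"
  "Trans (replace_guards M m \<psi> L) =
     {(p, L j, q) | p j q. j \<in> {1..m} \<and> (p, \<psi> j, q) \<in> Trans M}"
  by (simp_all add: replace_guards_def)

lemma count_list_map_inj_on:
  assumes "inj_on f A" "set xs \<subseteq> A" "a \<in> A"
  shows "count_list (map f xs) (f a) = count_list xs a"
  using assms(2) by (induction xs) (auto dest: inj_onD[OF assms(1)] simp: assms(3))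

lemma count_list_eq_card: "count_list xs a = card {n. n < length xs \<and> xs ! n = a}"
  by (simp add: count_list_eq_length_filter length_filter_conv_card eq_commute)

section \<open>Evaluating guards through the truth values of the generators\<close>

locale sfa_over_atoms =
  fixes A :: "('d, 'p) pred_algebra"
    and M :: "('q, 'p) automaton"
    and k m :: nat
    and \<phi> \<psi> :: "nat \<Rightarrow> 'p"
    and L :: "nat \<Rightarrow> bform"
  assumes algebra: "boolean_pred_algebra A"
    and generated: "generated_by A k \<phi>"
    and guards_eq: "guards M = \<psi> ` {1..m}"
    and formulas: "\<forall>j \<in> {1..m}. atoms (L j) \<subseteq> {1..k} \<and> pred_of A \<phi> (L j) = \<psi> j"
begin

abbreviation MF :: "('q, bform) automaton" where
  "MF \<equiv> replace_guards M m \<psi> L"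

lemma pred_of_in_Preds: "atoms F \<subseteq> {1..k} \<Longrightarrow> pred_of A \<phi> F \<in> Preds A"
  using generated by (auto simp: generated_by_def)

text \<open>Induction on \<open>F\<close>. The Boolean laws hold for members of
  \<open>Preds A\<close> only, so each case first places the immediate subformulas there by means of
  the generators.\<close>

lemma mem_Interp_pred_of:
  assumes "atoms F \<subseteq> {1..k}" "d \<in> Dom A"
  shows "d \<in> Interp A (pred_of A \<phi> F) \<longleftrightarrow> models (\<lambda>i. d \<in> Interp A (\<phi> i)) F"
  using assms(1)
proof (induction F)
  case (Or F G)
  then show ?case
    using algebra pred_of_in_Preds[of F] pred_of_in_Preds[of G]
    by (simp add: boolean_pred_algebra_def)
next
  case (And F G)
  then show ?case
    using algebra pred_of_in_Preds[of F] pred_of_in_Preds[of G]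
    by (simp add: boolean_pred_algebra_def)
next
  case (Neg F)
  then show ?case
    using algebra assms(2) pred_of_in_Preds[of F]
    by (simp add: boolean_pred_algebra_def)
qed (use algebra assms(2) in \<open>auto simp: boolean_pred_algebra_def\<close>)

lemma has_type_iff:
  assumes "d \<in> Dom A"
  shows "has_type A k \<phi> \<beta> d \<longleftrightarrow> (\<forall>i \<in> {1..k}. d \<in> Interp A (\<phi> i) \<longleftrightarrow> \<beta> i)"
proof -
  have "d \<in> Interp A (lit A (\<phi> i) (\<beta> i)) \<longleftrightarrow> (d \<in> Interp A (\<phi> i) \<longleftrightarrow> \<beta> i)"
    if "i \<in> {1..k}" for i
    using algebra assms pred_of_in_Preds[of "Atom i"] that
    by (simp add: lit_def boolean_pred_algebra_def)
  then show ?thesis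
    by (simp add: has_type_def)
qed

text \<open>The predicate \<open>\<psi> j\<close> is evaluated at \<open>d\<close> through the truth
  values of the generators at \<open>d\<close>. On \<open>{1..k}\<close>, which contains the atoms
  of \<open>L j\<close>, these are the bits of \<open>\<beta>\<close>.\<close>

lemma mem_Interp_guard_iff:
  assumes "j \<in> {1..m}" "d \<in> Dom A" "has_type A k \<phi> \<beta> d"
  shows "d \<in> Interp A (\<psi> j) \<longleftrightarrow> models \<beta> (L j)"
proof -
  have at: "atoms (L j) \<subseteq> {1..k}" and "\<psi> j = pred_of A \<phi> (L j)"
    using formulas assms(1) by auto
  then have "d \<in> Interp A (\<psi> j) \<longleftrightarrow> models (\<lambda>i. d \<in> Interp A (\<phi> i)) (L j)"
    using mem_Interp_pred_of assms(2) by simp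
  also have "\<dots> \<longleftrightarrow> models \<beta> (L j)"
    using at assms(2,3) by (intro models_cong) (auto simp: has_type_iff)
  finally show ?thesis .
qed

lemma Trans_guardE:
  assumes "(p, g, q) \<in> Trans M"
  obtains j where "j \<in> {1..m}" "g = \<psi> j"
  using assms guards_eq unfolding guards_def by blast

text \<open>Restricting to \<open>{1..k}\<close> makes the function extensional, as membership in
  \<open>bitvecs k\<close> demands.\<close>

definition type_of :: "'d \<Rightarrow> nat \<Rightarrow> bool" where
  "type_of d = (\<lambda>i\<in>{1..k}. d \<in> Interp A (\<phi> i))"

lemma type_of_in_bitvecs: "type_of d \<in> bitvecs k"
  by (auto simp: type_of_def bitvecs_def)

lemma has_type_type_of: "d \<in> Dom A \<Longrightarrow> has_type A k \<phi> (type_of d) d"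
  by (simp add: has_type_iff type_of_def)

section \<open>Accepted words and accepted tables\<close>

lemma word_table_iff_language:
  "word_table_formula A M k \<phi> m \<psi> L \<longleftrightarrow> language A M \<noteq> {}"
proof
  assume "word_table_formula A M k \<phi> m \<psi> L"
  then obtain S d t where d: "d \<in> lists (Dom A)"
    and Sd: "\<forall>i \<in> {1..k}. S i = {n. n < length d \<and> d ! n \<in> Interp A (\<phi> i)}"
    and t: "t \<in> tables k MF" "length t = length d"
    and St: "\<forall>i \<in> {1..k}. S i = {n. n < length t \<and> (t ! n) i}"
    unfolding word_table_formula_def by blast
  \<comment> \<open>Both descriptions of \<open>S i\<close> range over the same positions, so bit
    \<open>i\<close> of \<open>t ! n\<close> is the truth value of \<open>\<phi> i\<close> at
    \<open>d ! n\<close>.\<close>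
  have type: "has_type A k \<phi> (t ! n) (d ! n)" and dom: "d ! n \<in> Dom A"
    if "n < length t" for n
  proof -
    show "d ! n \<in> Dom A"
      using d t(2) that by (auto simp: in_lists_conv_set)
    then show "has_type A k \<phi> (t ! n) (d ! n)"
      using Sd St that t(2) by (auto simp: has_type_iff)
  qed
  have "accepts (\<lambda>p a. a \<in> Interp A p) M d"
  proof (rule accepts_transfer)
    show "accepts (\<lambda>F b. models b F) MF t"
      using t(1) by (simp add: tables_def)
  qed (use t(2) in \<open>auto simp: mem_Interp_guard_iff[OF _ dom type]\<close>)
  then show "language A M \<noteq> {}"
    using d by (auto simp: language_def)
next
  assume "language A M \<noteq> {}"
  then obtain d where d: "d \<in> lists (Dom A)" and acc: "accepts (\<lambda>p a. a \<in> Interp A p) M d"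
    by (auto simp: language_def)
  let ?t = "map type_of d"
  have dom: "d ! n \<in> Dom A" if "n < length d" for n
    using d that by (auto simp: in_lists_conv_set)
  have "accepts (\<lambda>F b. models b F) MF ?t"
  proof (rule accepts_transfer[OF acc])
    fix p g q n
    assume n: "n < length d" and tr: "(p, g, q) \<in> Trans M" and sat: "d ! n \<in> Interp A g"
    obtain j where "j \<in> {1..m}" "g = \<psi> j"
      using tr by (rule Trans_guardE)
    then show "\<exists>h. (p, h, q) \<in> Trans MF \<and> models (?t ! n) h"
      using n tr sat mem_Interp_guard_iff[OF _ dom[OF n] has_type_type_of[OF dom[OF n]]]
      by auto
  qed simp_all
  then have "?t \<in> tables k MF"
    by (auto simp: tables_def in_lists_conv_set type_of_in_bitvecs)
  then show "word_table_formula A M k \<phi> m \<psi> L"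
    unfolding word_table_formula_def
    by (intro exI[of _ "\<lambda>i. {n. n < length d \<and> d ! n \<in> Interp A (\<phi> i)}"] bexI[of _ d]
          conjI bexI[of _ ?t]) (auto simp: type_of_def d)
qed

section \<open>From an accepted word to the cardinality formula\<close>

text \<open>A letter may satisfy several guards, and several indices may name the same predicate.
  One index is therefore fixed at each step of an accepting run; the list of indices is kept because
  positions are later grouped by index.\<close>

lemma language_to_symbolic_table:
  assumes "accepts (\<lambda>p a. a \<in> Interp A p) M d"
  obtains js where "length js = length d" "set js \<subseteq> {1..m}" "map L js \<in> symbolic_tables MF"
    "\<And>n. n < length d \<Longrightarrow> d ! n \<in> Interp A (\<psi> (js ! n))"
proof -
  obtain r where r: "r 0 = Init M" "r (length d) \<in> Final M"
    and step: "\<forall>n < length d. \<exists>g. (r n, g, r (Suc n)) \<in> Trans M \<and> d ! n \<in> Interp A g"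
    using assms unfolding accepts_def by blast
  have "\<forall>n < length d. \<exists>j \<in> {1..m}.
      (r n, \<psi> j, r (Suc n)) \<in> Trans M \<and> d ! n \<in> Interp A (\<psi> j)"
    using step by (metis Trans_guardE)
  then obtain f where f: "\<And>n. n < length d \<Longrightarrow>
      f n \<in> {1..m} \<and> (r n, \<psi> (f n), r (Suc n)) \<in> Trans M \<and> d ! n \<in> Interp A (\<psi> (f n))"
    by metis
  let ?js = "map f [0..<length d]"
  have "accepts (=) MF (map L ?js)"
    unfolding accepts_def using r f by (intro exI[of _ r]) auto
  then show thesis
    using f by (intro that[of ?js]) (auto simp: symbolic_tables_def)
qed

text \<open>The clause about \<open>s = 0\<close> serves the variant with \<open>s\<close> at least
  1: a nonempty word yields a nonzero \<open>s\<close>.\<close>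

lemma cardinality_formula_of_word:
  assumes inj: "inj_on L {1..m}"
    and \<rho>: "defines_set \<rho> m (parikh_image m L (symbolic_tables MF))"
    and d: "d \<in> language A M"
  shows "\<exists>s \<in> {0..m}. (s = 0 \<longrightarrow> d = []) \<and> cardinality_formula A k \<phi> m L \<rho> s"
proof -
  have dom: "d ! n \<in> Dom A" if "n < length d" for n
    using d that by (auto simp: language_def in_lists_conv_set)
  obtain js where len: "length js = length d" and js: "set js \<subseteq> {1..m}"
    and sym: "map L js \<in> symbolic_tables MF"
    and sat: "\<And>n. n < length d \<Longrightarrow> d ! n \<in> Interp A (\<psi> (js ! n))"
    using d language_to_symbolic_table unfolding language_def by blast
  define s where "s = card (set js)"
  obtain \<sigma> where \<sigma>: "bij_betw \<sigma> {1..s} (set js)"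
    using ex_bij_betw_nat_finite_1[of "set js"] s_def by auto
  have "s \<le> m"
    using card_mono[OF _ js] s_def by simp
  have s0: "s = 0 \<longrightarrow> d = []"
    using len s_def by auto
  have im: "\<sigma> ` {1..s} = set js" and inj\<sigma>: "inj_on \<sigma> {1..s}"
    using \<sigma> by (auto simp: bij_betw_def)
  \<comment> \<open>Grouping by the chosen index, not by all satisfied guards, keeps these sets
    disjoint even where regions overlap.\<close>
  define pos where "pos i = {n. n < length d \<and> js ! n = \<sigma> i}" for i
  define S where "S i = {n. n < length d \<and> d ! n \<in> Interp A (\<phi> i)}" for i
  define \<kappa> where "\<kappa> = (\<lambda>j\<in>{1..m}. count_list (map L js) (L j))"
  \<comment> \<open>Injectivity of \<open>L\<close> turns the count of a formula into the count of
    its index.\<close>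
  have \<kappa>: "\<kappa> j = count_list js j" if "j \<in> {1..m}" for j
    using that count_list_map_inj_on[OF inj js that] by (simp add: \<kappa>_def)
  have "\<exists>n. n \<in> pos i" if "i \<in> {1..s}" for i
  proof -
    have "\<sigma> i \<in> set js"
      using im that by blast
    then show ?thesis
      by (auto simp: pos_def in_set_conv_nth len)
  qed
  then obtain w where w: "\<And>i. i \<in> {1..s} \<Longrightarrow> w i \<in> pos i"
    by metis
  have js_nth: "js ! n \<in> {1..m}" if "n < length d" for n
    using js that len by (metis nth_mem subsetD)
  have region: "n \<in> region {..<length d} k S (L (js ! n))" if n: "n < length d" for n
  proof -
    have at: "atoms (L (js ! n)) \<subseteq> {1..k}"
      using formulas js_nth[OF n] by blast
    have "models (type_of (d ! n)) (L (js ! n))"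
      using mem_Interp_guard_iff[OF js_nth[OF n] dom[OF n] has_type_type_of[OF dom[OF n]]] sat[OF n]
      by blast
    moreover have "models (type_of (d ! n)) (L (js ! n)) \<longleftrightarrow> models (\<lambda>i. n \<in> S i) (L (js ! n))"
      using at n by (intro models_cong) (auto simp: type_of_def S_def)
    ultimately show ?thesis
      using n by (simp add: mem_region_iff[OF at])
  qed
  have "cardinality_formula A k \<phi> m L \<rho> s"
    unfolding cardinality_formula_def
  \<comment> \<open>The vector for \<open>i\<close> is the type of the letter at \<open>w i\<close>:
    that letter realises it, and \<open>w i\<close> is a common point of its cell and
    \<open>pos i\<close>.\<close>
  proof (intro exI[of _ \<sigma>] exI[of _ "\<lambda>i. type_of (d ! w i)"] bexI[of _ \<kappa>]
      exI[of _ "length d"] conjI ballI; (rule exI[of _ S], rule exI[of _ pos], intro conjI ballI)?)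
    show "\<sigma> ` {1..s} \<subseteq> {1..m}"
      using im js by simp
    show "\<exists>c \<in> Dom A. has_type A k \<phi> (type_of (d ! w i)) c" if "i \<in> {1..s}" for i
      using dom has_type_type_of w[OF that] by (auto simp: pos_def)
    show "holds \<rho> \<kappa>"
      using \<rho> sym by (auto simp: defines_set_def parikh_image_def \<kappa>_def)
    show "\<kappa> j = 0" if "j \<in> {1..m} - \<sigma> ` {1..s}" for j
      using that im \<kappa> by simp
    show "pos i \<subseteq> region {..<length d} k S (L (\<sigma> i))" if "i \<in> {1..s}" for i
    proof
      fix n
      assume "n \<in> pos i"
      then show "n \<in> region {..<length d} k S (L (\<sigma> i))"
        using region[of n] by (simp add: pos_def)
    qed
    show "(\<Union>i \<in> {1..m}. region {..<length d} k S (L i)) = (\<Union>i \<in> {1..s}. pos i)"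
    proof
      show "(\<Union>i \<in> {1..s}. pos i) \<subseteq> (\<Union>i \<in> {1..m}. region {..<length d} k S (L i))"
      proof
        fix n
        assume "n \<in> (\<Union>i \<in> {1..s}. pos i)"
        then have "n < length d"
          by (auto simp: pos_def)
        then show "n \<in> (\<Union>i \<in> {1..m}. region {..<length d} k S (L i))"
          using region js_nth by blast
      qed
      \<comment> \<open>The sets \<open>pos i\<close> exhaust the universe, since
        \<open>\<sigma>\<close> enumerates every index in \<open>js\<close>; regions cannot exceed
        it.\<close>
      have "n \<in> (\<Union>i \<in> {1..s}. pos i)" if "n < length d" for n
      proof -
        have "js ! n \<in> \<sigma> ` {1..s}"
          using im that len by simp
        then show ?thesis
          using that by (auto simp: pos_def)
      qed
      moreover have "region {..<length d} k S F \<subseteq> {..<length d}" for F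
        by (auto simp: region_def cell_def)
      ultimately show
        "(\<Union>i \<in> {1..m}. region {..<length d} k S (L i)) \<subseteq> (\<Union>i \<in> {1..s}. pos i)"
        by blast
    qed
    show "disjoint_family_on pos {1..s}"
      unfolding disjoint_family_on_def
    proof (intro ballI impI)
      fix i j
      assume "i \<in> {1..s}" "j \<in> {1..s}" "i \<noteq> j"
      then have "\<sigma> i \<noteq> \<sigma> j"
        using inj\<sigma> by (metis inj_onD)
      then show "pos i \<inter> pos j = {}"
        by (auto simp: pos_def)
    qed
    show "card (pos i) = \<kappa> (\<sigma> i)" if "i \<in> {1..s}" for i
    proof -
      have "\<sigma> i \<in> {1..m}"
        using im js that by blast
      then show ?thesis
        by (simp add: \<kappa> count_list_eq_card pos_def len)
    qed
    show "cell {..<length d} k S (type_of (d ! w i)) \<inter> pos i \<noteq> {}" if "i \<in> {1..s}" for i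
    proof -
      have "w i \<in> cell {..<length d} k S (type_of (d ! w i))"
        using w[OF that] by (auto simp: mem_cell_iff type_of_def S_def pos_def)
      then show ?thesis
        using w[OF that] by blast
    qed
    show "S i \<subseteq> {..<length d}" for i
      by (auto simp: S_def)
  qed (use inj\<sigma> in \<open>simp_all add: type_of_in_bitvecs \<kappa>_def\<close>)
  then show ?thesis
    using \<open>s \<le> m\<close> s0 by (intro bexI[of _ s]) simp_all
qed

section \<open>From the cardinality formula to an accepted word\<close>

lemma word_of_cardinality_formula:
  assumes \<rho>: "defines_set \<rho> m (parikh_image m L (symbolic_tables MF))"
    and "cardinality_formula A k \<phi> m L \<rho> s"
  shows "language A M \<noteq> {}"
proof -
  obtain \<sigma> \<beta> \<kappa> N S P where \<sigma>: "\<sigma> ` {1..s} \<subseteq> {1..m}"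
    and real: "\<forall>j \<in> {1..s}. \<exists>d \<in> Dom A. has_type A k \<phi> (\<beta> j) d"
    and "\<kappa> \<in> {1..m} \<rightarrow>\<^sub>E UNIV" "holds \<rho> \<kappa>"
    and zero: "\<forall>j \<in> {1..m} - \<sigma> ` {1..s}. \<kappa> j = 0"
    and P: "\<forall>i \<in> {1..s}. P i \<subseteq> region {..<N} k S (L (\<sigma> i))"
    and ne: "\<forall>i \<in> {1..s}. cell {..<N} k S (\<beta> i) \<inter> P i \<noteq> {}"
    using assms(2) unfolding cardinality_formula_def by (elim exE conjE bexE) blast
  then have "\<kappa> \<in> parikh_image m L (symbolic_tables MF)"
    using \<rho> by (auto simp: defines_set_def)
  then obtain w where w: "accepts (=) MF w" "\<kappa> = (\<lambda>j\<in>{1..m}. count_list w (L j))"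
    by (auto simp: parikh_image_def symbolic_tables_def)
  \<comment> \<open>The letter depends on the formula \<open>F\<close> only, not on its position in
    \<open>w\<close>. It must satisfy \<open>\<psi> j\<close> for every \<open>j\<close> with
    \<open>L j = F\<close>, since a transition labelled \<open>F\<close> may stem from any such
    \<open>j\<close>.\<close>
  have letter: "\<exists>d \<in> Dom A. \<forall>j \<in> {1..m}. L j = F \<longrightarrow> d \<in> Interp A (\<psi> j)"
    if F: "F \<in> set w" for F
  proof -
    obtain j where j: "j \<in> {1..m}" "L j = F"
      using F accepts_letterD[OF w(1)] by (fastforce simp: in_set_conv_nth)
    \<comment> \<open>Here the conjunct on letters outside the range of \<open>\<sigma>\<close>
      enters: an occurring \<open>F\<close> has a nonzero count, so its index is some
      \<open>\<sigma> i\<close> and \<open>\<beta> i\<close> is available.\<close>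
    then have "\<kappa> j \<noteq> 0"
      using F w(2) by (simp add: count_list_0_iff)
    then have "j \<in> \<sigma> ` {1..s}"
      using zero j(1) by (metis DiffI)
    then obtain i where i: "i \<in> {1..s}" "\<sigma> i = j"
      by blast
    \<comment> \<open>The common point links the two sides: lying in \<open>P i\<close> makes its
      membership pattern a model of \<open>F\<close>, and lying in the cell makes that pattern equal
      to \<open>\<beta> i\<close> on \<open>{1..k}\<close>.\<close>
    obtain n where n: "n \<in> cell {..<N} k S (\<beta> i)" "n \<in> P i"
      using ne i(1) by blast
    have at: "atoms F \<subseteq> {1..k}"
      using formulas j by blast
    have "models (\<lambda>i. n \<in> S i) F"
      using P i n(2) j(2) mem_region_iff[OF at] by blast
    moreover have "models (\<lambda>i. n \<in> S i) F \<longleftrightarrow> models (\<beta> i) F"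
      using at n(1) by (intro models_cong) (auto simp: mem_cell_iff)
    moreover obtain d where "d \<in> Dom A" "has_type A k \<phi> (\<beta> i) d"
      using real i(1) by blast
    ultimately show ?thesis
      using mem_Interp_guard_iff by blast
  qed
  then obtain c where c: "\<And>F. F \<in> set w \<Longrightarrow>
      c F \<in> Dom A \<and> (\<forall>j \<in> {1..m}. L j = F \<longrightarrow> c F \<in> Interp A (\<psi> j))"
    by metis
  have "accepts (\<lambda>p a. a \<in> Interp A p) M (map c w)"
    by (rule accepts_transfer[OF w(1)]) (use c nth_mem in \<open>fastforce+\<close>)
  moreover have "map c w \<in> lists (Dom A)"
    using c by auto
  ultimately show ?thesis
    by (auto simp: language_def)
qed

end

theorem theorem1:
  fixes A :: "('d, 'p) pred_algebra"
    and M :: "('q, 'p) automaton"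
    and k m :: nat
    and \<phi> \<psi> :: "nat \<Rightarrow> 'p"
    and L :: "nat \<Rightarrow> bform"
    and \<rho> :: epresburger
  assumes "boolean_pred_algebra A"
    and "generated_by A k \<phi>"
    and "symbolic_automaton A M"
    and "guards M = \<psi> ` {1..m}"
    and "\<forall>j \<in> {1..m}. atoms (L j) \<subseteq> {1..k} \<and> pred_of A \<phi> (L j) = \<psi> j"
    and "inj_on L {1..m}"
    and "defines_set \<rho> m (parikh_image m L (symbolic_tables (replace_guards M m \<psi> L)))"
  shows "(word_table_formula A M k \<phi> m \<psi> L \<longleftrightarrow> language A M \<noteq> {}) \<and>
         (word_table_formula A M k \<phi> m \<psi> L \<longleftrightarrow>
            (\<exists>s \<in> {0..m}. cardinality_formula A k \<phi> m L \<rho> s)) \<and>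
         ([] \<notin> language A M \<longrightarrow>
            (word_table_formula A M k \<phi> m \<psi> L \<longleftrightarrow>
               (\<exists>s \<in> {1..m}. cardinality_formula A k \<phi> m L \<rho> s)))"
proof -
  interpret sfa_over_atoms A M k m \<phi> \<psi> L
    using assms by unfold_locales
  note toword = word_of_cardinality_formula[OF assms(7)]
  note ofword = cardinality_formula_of_word[OF assms(6,7)]
  have "language A M \<noteq> {} \<longleftrightarrow> (\<exists>s \<in> {0..m}. cardinality_formula A k \<phi> m L \<rho> s)"
    using toword ofword by blast
  moreover have "language A M \<noteq> {} \<longleftrightarrow> (\<exists>s \<in> {1..m}. cardinality_formula A k \<phi> m L \<rho> s)"
    if "[] \<notin> language A M"
  proof
    assume "language A M \<noteq> {}"
    then obtain d where d: "d \<in> language A M"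
      by blast
    then have "d \<noteq> []"
      using that by blast
    then show "\<exists>s \<in> {1..m}. cardinality_formula A k \<phi> m L \<rho> s"
      using ofword[OF d] by (metis One_nat_def Suc_leI atLeastAtMost_iff neq0_conv)
  qed (use toword in blast)
  ultimately show ?thesis
    using word_table_iff_language by blast
qed

end
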